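(* Let $n\ge1$, $u_1,\ldots,u_n,v_1,\ldots,v_n\geq 1$ and $N\geq 0$ be integers such that $v_1+\cdots+v_n\geq N+1$. Then the integral $$\int_{[0,1]^n}\dfrac{x_1^{u_1-1}\cdots x_n^{u_n-1}(1-x_1)^{v_1-1}\cdots (1-x_n)^{v_n-1}}{(1-x_1\cdots x_n)^N}\,dx_1\cdots dx_n$$ is absolutely convergent, and there are rational numbers $a_0,a_2,a_3,\ldots,a_n$ such that it equals $$a_0+a_2\zeta(2)+a_3\zeta(3)+\cdots+a_n\zeta(n)$$ and such that, if furthermore $2u_i+v_i=N+1$ for every $i$, then: (1) if $(n+1)(N+1)$ is odd then $a_k=0$ for $k\neq 0$ even; (2) if $(n+1)(N+1)$ is even then $a_k=0$ for $k$ odd.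
   Context: $\zeta(k)=\sum_{m\ge1}m^{-k}$ for integers $k\ge2$. *)

theory Defs
  imports "HOL-Analysis.Analysis"
begin

definition zeta :: "nat \<Rightarrow> real" where
  "zeta k = (\<Sum>m. 1 / real (Suc m) ^ k)"

text \<open>A point of n-dimensional space is a function on the index set \<open>{1..n}\<close>, and Lebesgue
  measure is the product of n copies of \<^term>\<open>lborel\<close>.\<close>

definition lebesgue_pow :: "nat \<Rightarrow> (nat \<Rightarrow> real) measure" where
  "lebesgue_pow n = (\<Pi>\<^sub>M i\<in>{1..n}. lborel)"

definition unit_cube :: "nat \<Rightarrow> (nat \<Rightarrow> real) set" where
  "unit_cube n = (\<Pi>\<^sub>E i\<in>{1..n}. {0..1})"

text \<open>Where the denominator vanishes (for \<open>N > 0\<close>, only at the corner of the cube with all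
  coordinates 1), HOL assigns the value 0; this is a null set.\<close>

definition integrand ::
  "nat \<Rightarrow> (nat \<Rightarrow> nat) \<Rightarrow> (nat \<Rightarrow> nat) \<Rightarrow> nat \<Rightarrow> (nat \<Rightarrow> real) \<Rightarrow> real" where
  "integrand n u v N x =
     (\<Prod>i=1..n. x i ^ (u i - 1)) * (\<Prod>i=1..n. (1 - x i) ^ (v i - 1))
       / (1 - (\<Prod>i=1..n. x i)) ^ N"

end

(*
  Expanding (1 - x_1...x_n)^(-N) by the binomial series and integrating term by term (beta
  integrals) turns the integral into a series sum_m R(m) with R a rational function all of whose
  poles are at negative integers -j and have order at most n. Write R as the sum of the partial
  fractions c_{j,k}/(x+j)^k. As x R(x) tends to 0, the residues c_{j,1} sum to 0, so summing over m
  gives a rational number plus the zeta(k), k >= 2, with coefficients sum_j c_{j,k}.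
  If 2u_i + v_i = N+1 for all i, then R(-x-N) = eps R(x) with eps = (-1)^((n+1)(N+1)); averaging the
  partial fraction expansion with its reflection gives one with c_{N-j,k} = eps (-1)^k c_{j,k},
  so that sum_j c_{j,k} vanishes whenever eps (-1)^k = -1.
*)
theory Submission
  imports Defs
begin

section \<open>Partial fractions with rational coefficients\<close>

text \<open>The poles lie at \<open>-1\<close>, ..., \<open>-M\<close>. The bound \<open>e j\<close>
  depends on \<open>j\<close> because expansions are built factor by factor, each factor raising the
  order of a single pole.\<close>

definition pfsum :: "nat \<Rightarrow> (nat \<Rightarrow> nat) \<Rightarrow> (nat \<Rightarrow> nat \<Rightarrow> real) \<Rightarrow> real \<Rightarrow> real" where
  "pfsum M e c x = (\<Sum>j=1..M. \<Sum>k=1..e j. c j k / (x + real j) ^ k)"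

text \<open>The condition \<open>c j k = 0\<close> for \<open>k > e j\<close> does not affect the sum; it makes the index shift
  \<open>c j (Suc k)\<close> in \<open>pfsum_mult_linear\<close> harmless at the top order.\<close>

definition has_pf :: "nat \<Rightarrow> (nat \<Rightarrow> nat) \<Rightarrow> (real \<Rightarrow> real) \<Rightarrow> bool" where
  "has_pf M e f \<longleftrightarrow> (\<exists>c. (\<forall>j k. c j k \<in> \<rat>) \<and> (\<forall>j k. e j < k \<longrightarrow> c j k = 0) \<and>
     (\<forall>x. (\<forall>j\<in>{1..M}. x + real j \<noteq> 0) \<longrightarrow> f x = pfsum M e c x))"

section \<open>Linear operations on expansions\<close>

lemma pfsum_truncate: "pfsum M e (\<lambda>j k. if k \<le> e j then c j k else 0) x = pfsum M e c x"
  unfolding pfsum_def by (intro sum.cong refl) auto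

lemma has_pfI:
  assumes "\<And>j k. c j k \<in> \<rat>"
    and "\<And>x. (\<And>j. j \<in> {1..M} \<Longrightarrow> x + real j \<noteq> 0) \<Longrightarrow> f x = pfsum M e c x"
  shows "has_pf M e f"
  unfolding has_pf_def
  by (rule exI[of _ "\<lambda>j k. if k \<le> e j then c j k else 0"]) (use assms in \<open>simp add: pfsum_truncate\<close>)

lemma has_pf_cong:
  assumes "has_pf M e f" "\<And>x. (\<And>j. j \<in> {1..M} \<Longrightarrow> x + real j \<noteq> 0) \<Longrightarrow> f x = g x"
  shows "has_pf M e g"
  using assms unfolding has_pf_def by metis

lemma has_pf_cmult:
  assumes "has_pf M e f" "r \<in> \<rat>"
  shows "has_pf M e (\<lambda>x. r * f x)"
proof -
  obtain c where c: "\<And>j k. c j k \<in> \<rat>"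
    "\<And>x. (\<forall>j\<in>{1..M}. x + real j \<noteq> 0) \<Longrightarrow> f x = pfsum M e c x"
    using assms unfolding has_pf_def by auto
  show ?thesis
    by (rule has_pfI[of "\<lambda>j k. r * c j k"])
       (use c assms(2) in \<open>auto simp: pfsum_def sum_distrib_left\<close>)
qed

lemma has_pf_add:
  assumes "has_pf M e f" "has_pf M e g"
  shows "has_pf M e (\<lambda>x. f x + g x)"
proof -
  obtain c where c: "\<And>j k. c j k \<in> \<rat>"
    "\<And>x. (\<forall>j\<in>{1..M}. x + real j \<noteq> 0) \<Longrightarrow> f x = pfsum M e c x"
    using assms unfolding has_pf_def by auto
  obtain d where d: "\<And>j k. d j k \<in> \<rat>"
    "\<And>x. (\<forall>j\<in>{1..M}. x + real j \<noteq> 0) \<Longrightarrow> g x = pfsum M e d x"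
    using assms unfolding has_pf_def by auto
  show ?thesis
    by (rule has_pfI[of "\<lambda>j k. c j k + d j k"])
       (use c d in \<open>auto simp: pfsum_def sum.distrib add_divide_distrib\<close>)
qed

lemma has_pf_sum:
  assumes "\<And>i. i \<in> I \<Longrightarrow> has_pf M e (f i)"
  shows "has_pf M e (\<lambda>x. \<Sum>i\<in>I. f i x)"
  using assms
proof (induction I rule: infinite_finite_induct)
  case (insert i I)
  then show ?case by (auto intro: has_pf_add)
qed (auto intro!: has_pfI[of "\<lambda>_ _. 0"] simp: pfsum_def)

lemma has_pf_basis:
  assumes "j \<in> {1..M}" "k \<in> {1..e j}"
  shows "has_pf M e (\<lambda>x. 1 / (x + real j) ^ k)"
proof (rule has_pfI[of "\<lambda>j' k'. if j' = j then if k' = k then 1 else 0 else 0"])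
  fix x
  have "pfsum M e (\<lambda>j' k'. if j' = j then if k' = k then 1 else 0 else 0) x
     = (\<Sum>j'=1..M. if j' = j then (\<Sum>k'=1..e j. (if k' = k then 1 else 0) / (x + real j) ^ k') else 0)"
    unfolding pfsum_def
  proof (intro sum.cong refl)
    fix j'
    show "(\<Sum>k'=1..e j'. (if j' = j then if k' = k then 1 else 0 else 0) / (x + real j') ^ k')
      = (if j' = j then (\<Sum>k'=1..e j. (if k' = k then 1 else 0) / (x + real j) ^ k') else 0)"
      by (cases "j' = j") simp_all
  qed
  also have "\<dots> = (\<Sum>k'=1..e j. (if k' = k then 1 else 0) / (x + real j) ^ k')"
    using assms by (simp only: sum.delta finite_atLeastAtMost if_True)
  also have "\<dots> = (\<Sum>k'=1..e j. if k' = k then 1 / (x + real j) ^ k else 0)"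
    by (intro sum.cong refl) simp
  also have "\<dots> = 1 / (x + real j) ^ k"
    using assms by (simp only: sum.delta finite_atLeastAtMost if_True)
  finally show "1 / (x + real j) ^ k =
    pfsum M e (\<lambda>j' k'. if j' = j then if k' = k then 1 else 0 else 0) x" by simp
qed auto

lemma has_pf_mono:
  assumes "has_pf M e f" "\<And>j. j \<in> {1..M} \<Longrightarrow> e j \<le> e' j"
  shows "has_pf M e' f"
proof -
  obtain c where c: "\<And>j k. c j k \<in> \<rat>"
    "\<And>x. (\<forall>j\<in>{1..M}. x + real j \<noteq> 0) \<Longrightarrow> f x = pfsum M e c x"
    using assms unfolding has_pf_def by auto
  have "has_pf M e' (\<lambda>x. \<Sum>j=1..M. \<Sum>k=1..e j. c j k * (1 / (x + real j) ^ k))"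
  proof (intro has_pf_sum has_pf_cmult has_pf_basis c(1))
    fix j k assume "j \<in> {1..M}" "k \<in> {1..e j}"
    then show "k \<in> {1..e' j}" using assms(2)[of j] by auto
  qed
  then show ?thesis
    by (rule has_pf_cong) (use c(2) in \<open>auto simp: pfsum_def\<close>)
qed

section \<open>Division by linear factors\<close>

text \<open>For distinct poles, \<open>1 / ((x + i) * (x + j)) = (1 / (x + i) - 1 / (x + j)) / (j -
  i)\<close> lowers \<open>k\<close> step by step, down to the simple pole at \<open>-i\<close>. For
  \<open>i = j\<close> the order of the pole grows by one, hence \<open>k < e j\<close>
  there.\<close>

lemma has_pf_basis_div:
  assumes "i \<in> {1..M}" "j \<in> {1..M}" "1 \<le> k" "k \<le> e j" "i \<noteq> j \<Longrightarrow> 1 \<le> e i" "i = j \<Longrightarrow> k < e j"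
  shows "has_pf M e (\<lambda>x. 1 / ((x + real i) * (x + real j) ^ k))"
proof (cases "i = j")
  case True
  then show ?thesis using has_pf_basis[of j M "Suc k" e] assms by simp
next
  case False
  have "k \<le> e j \<Longrightarrow> has_pf M e (\<lambda>x. 1 / ((x + real i) * (x + real j) ^ k))" for k
  proof (induction k)
    case 0
    then show ?case using has_pf_basis[of i M 1 e] assms False by simp
  next
    case (Suc k)
    have *: "has_pf M e (\<lambda>x. (1 / (real j - real i)) * (1 / ((x + real i) * (x + real j) ^ k)
         + (-1) * (1 / (x + real j) ^ Suc k)))"
      using Suc assms False
      by (intro has_pf_cmult has_pf_add has_pf_basis) auto
    show ?case
    proof (rule has_pf_cong[OF *])
      fix x assume x: "\<And>j. j \<in> {1..M} \<Longrightarrow> x + real j \<noteq> 0"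
      define p where "p = (x + real j) ^ k"
      have "x + real i \<noteq> 0" "x + real j \<noteq> 0" "p \<noteq> 0" "real j - real i \<noteq> 0"
        using x[of i] x[of j] assms False by (auto simp: p_def)
      then show "1 / (real j - real i) * (1 / ((x + real i) * (x + real j) ^ k) + (- 1) * (1 / (x + real j) ^ Suc k))
          = 1 / ((x + real i) * (x + real j) ^ Suc k)"
        unfolding power_Suc p_def[symmetric] by (simp add: divide_simps)
    qed
  qed
  then show ?thesis using assms by simp
qed

text \<open>A term with another pole contributes at most a simple pole at \<open>-i\<close>, and a
  term with pole \<open>-i\<close> has its order raised by one; so only the bound at
  \<open>i\<close> changes.\<close>

lemma has_pf_div_linear:
  assumes "has_pf M e f" "i \<in> {1..M}"
  shows "has_pf M (e(i := Suc (e i))) (\<lambda>x. f x / (x + real i))"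
proof -
  obtain c where c: "\<And>j k. c j k \<in> \<rat>"
    "\<And>x. (\<forall>j\<in>{1..M}. x + real j \<noteq> 0) \<Longrightarrow> f x = pfsum M e c x"
    using assms unfolding has_pf_def by auto
  have "has_pf M (e(i := Suc (e i)))
     (\<lambda>x. \<Sum>j=1..M. \<Sum>k=1..e j. c j k * (1 / ((x + real i) * (x + real j) ^ k)))"
    by (intro has_pf_sum has_pf_cmult has_pf_basis_div c(1)) (use assms in auto)
  then show ?thesis
    by (rule has_pf_cong) (use c(2) in \<open>auto simp: pfsum_def sum_divide_distrib field_simps\<close>)
qed

text \<open>Indexing the factors by \<open>S\<close> keeps track of multiplicities: factors are
  divided in one at a time. The empty product is excluded because the constant 1 does not vanish at
  infinity and so has no expansion of this kind.\<close>

lemma has_pf_inverse_prod: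
  assumes "finite S" "S \<noteq> {}" "\<And>s. s \<in> S \<Longrightarrow> g s \<in> {1..M}"
  shows "has_pf M (\<lambda>j. card {s\<in>S. g s = j}) (\<lambda>x. 1 / (\<Prod>s\<in>S. x + real (g s)))"
  using assms
proof (induction S rule: finite_ne_induct)
  case (singleton s)
  have "{t \<in> {s}. g t = g s} = {s}" by auto
  then show ?case using has_pf_basis[of "g s" M 1 "\<lambda>j. card {t \<in> {s}. g t = j}"] singleton
    by simp
next
  case (insert s S)
  have e: "(\<lambda>j. card {t \<in> insert s S. g t = j}) =
      (\<lambda>j. card {t \<in> S. g t = j})(g s := Suc (card {t \<in> S. g t = g s}))"
  proof
    fix j
    have "{t \<in> insert s S. g t = j} = (if g s = j then insert s {t \<in> S. g t = j} else {t \<in> S. g t = j})"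
      by auto
    then show "card {t \<in> insert s S. g t = j} =
      ((\<lambda>j. card {t \<in> S. g t = j})(g s := Suc (card {t \<in> S. g t = g s}))) j"
      using insert by auto
  qed
  show ?case unfolding e
    by (rule has_pf_cong[OF has_pf_div_linear[OF insert.IH, of "g s"]])
       (use insert in \<open>auto simp: mult.commute\<close>)
qed

section \<open>Multiplication by linear factors and behaviour at infinity\<close>

text \<open>Write \<open>x + a\<close> as \<open>(x + j) + (a - j)\<close> in the terms with pole
  \<open>-j\<close>: the first summand lowers each order by one, the second only rescales. The terms
  of order one become constants, which add up to the sum of the residues.\<close>

lemma pfsum_mult_linear:
  assumes "\<And>j. j \<in> {1..M} \<Longrightarrow> x + real j \<noteq> 0" "\<And>j k. e j < k \<Longrightarrow> c j k = 0"
  shows "(x + a) * pfsum M e c x =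
    pfsum M e (\<lambda>j k. c j k * (a - real j) + c j (Suc k)) x + (\<Sum>j=1..M. c j 1)"
proof -
  \<comment> \<open>The extra summand \<open>d (Suc K) / y ^ K\<close> closes the induction for
    arbitrary \<open>d\<close>; at \<open>K = e j\<close> it vanishes because \<open>c\<close> does
    beyond \<open>e j\<close>.\<close>
  have shift: "(y + b) * (\<Sum>k=1..K. d k / y ^ k) + d (Suc K) / y ^ K
      = (\<Sum>k=1..K. (d k * b + d (Suc k)) / y ^ k) + d 1"
    if "y \<noteq> 0" for y b :: real and d K
  proof (induction K)
    case (Suc K)
    have "(y + b) * (\<Sum>k=1..Suc K. d k / y ^ k) + d (Suc (Suc K)) / y ^ Suc K
      = ((y + b) * (\<Sum>k=1..K. d k / y ^ k) + d (Suc K) / y ^ K)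
        + (d (Suc K) * b + d (Suc (Suc K))) / y ^ Suc K"
      using that by (simp add: field_simps)
    then show ?case using Suc by simp
  qed auto
  have "(x + a) * (\<Sum>k=1..e j. c j k / (x + real j) ^ k)
     = (\<Sum>k=1..e j. (c j k * (a - real j) + c j (Suc k)) / (x + real j) ^ k) + c j 1"
    if "j \<in> {1..M}" for j
    using shift[of "x + real j" "a - real j" "c j" "e j"] assms that by simp
  then show ?thesis unfolding pfsum_def sum_distrib_left sum.distrib[symmetric]
    by (intro sum.cong) auto
qed

lemma pfsum_tendsto_0: "(\<lambda>m. pfsum M e c (real m)) \<longlonglongrightarrow> 0"
  unfolding pfsum_def
proof (intro tendsto_null_sum)
  fix j k assume k: "k \<in> {1..e j}"
  have "(\<lambda>m. 1 / (real m + real j)) \<longlonglongrightarrow> 0"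
    using LIMSEQ_ignore_initial_segment[OF lim_1_over_n, of j] by simp
  from tendsto_mult_right_zero[OF tendsto_null_power[OF this, of k], of "c j k"]
  show "(\<lambda>m. c j k / (real m + real j) ^ k) \<longlonglongrightarrow> 0"
    using k by (simp add: power_one_over)
qed

text \<open>Along the natural numbers the product tends to the sum of the residues, so the limit
  hypothesis kills the constant that would otherwise remain as a polynomial part.\<close>

lemma has_pf_mult_linear:
  assumes "has_pf M e f" "a \<in> \<rat>" "(\<lambda>m. (real m + a) * f (real m)) \<longlonglongrightarrow> 0"
  shows "has_pf M e (\<lambda>x. (x + a) * f x)"
proof -
  obtain c where c: "\<And>j k. c j k \<in> \<rat>" "\<And>j k. e j < k \<Longrightarrow> c j k = 0"
    "\<And>x. (\<forall>j\<in>{1..M}. x + real j \<noteq> 0) \<Longrightarrow> f x = pfsum M e c x"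
    using assms unfolding has_pf_def by auto
  define d where "d = (\<lambda>j k. c j k * (a - real j) + c j (Suc k))"
  have eq: "(x + a) * f x = pfsum M e d x + (\<Sum>j=1..M. c j 1)"
    if "\<forall>j\<in>{1..M}. x + real j \<noteq> 0" for x
    using pfsum_mult_linear[of M x e c a] c that by (simp add: d_def)
  have "(real m + a) * f (real m) = pfsum M e d (real m) + (\<Sum>j=1..M. c j 1)" for m
    by (rule eq) auto
  then have "(\<lambda>m. pfsum M e d (real m) + (\<Sum>j=1..M. c j 1)) \<longlonglongrightarrow> 0"
    using assms(3) by simp
  moreover have "(\<lambda>m. pfsum M e d (real m) + (\<Sum>j=1..M. c j 1)) \<longlonglongrightarrow> 0 + (\<Sum>j=1..M. c j 1)"
    by (intro tendsto_intros pfsum_tendsto_0)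
  ultimately have "(\<Sum>j=1..M. c j 1) = 0" using LIMSEQ_unique by fastforce
  then show ?thesis
    by (intro has_pfI[of d]) (use eq c(1) assms(2) in \<open>auto simp: d_def\<close>)
qed

text \<open>For \<open>m \<ge> 1\<close> the numerator is at most \<open>((s + 1) * m) ^ s\<close>
  and the denominator at least \<open>m ^ (s + 1)\<close>.\<close>

lemma rational_fun_tendsto_0:
  fixes g :: "'a \<Rightarrow> nat"
  assumes "finite S" "s < card S"
  shows "(\<lambda>m. (\<Prod>i=1..s. real m + real i) / (\<Prod>t\<in>S. real m + real (g t))) \<longlonglongrightarrow> 0"
proof (rule tendsto_sandwich[of "\<lambda>_. 0" _ _ "\<lambda>m. real (Suc s) ^ s / real m"])
  show "(\<lambda>m. real (Suc s) ^ s / real m) \<longlonglongrightarrow> 0"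
    by (rule lim_const_over_n)
  show "\<forall>\<^sub>F m in sequentially. (\<Prod>i=1..s. real m + real i) / (\<Prod>t\<in>S. real m + real (g t))
      \<le> real (Suc s) ^ s / real m"
    using eventually_ge_at_top[of 1]
  proof eventually_elim
    case (elim m)
    have "(\<Prod>i=1..s. real m + real i) \<le> (\<Prod>i=1..s. real (Suc s) * real m)"
    proof (intro prod_mono conjI)
      fix i assume "i \<in> {1..s}"
      then have "real i \<le> real s * real m" using elim
        by (metis atLeastAtMost_iff le_trans mult.right_neutral mult_le_mono of_nat_le_iff of_nat_mult)
      then show "real m + real i \<le> real (Suc s) * real m" by (simp add: algebra_simps)
    qed auto
    then have "(\<Prod>i=1..s. real m + real i) \<le> (real (Suc s) * real m) ^ s" by simp
    moreover have "(\<Prod>t\<in>S. real m) \<le> (\<Prod>t\<in>S. real m + real (g t))"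
      by (intro prod_mono) auto
    then have "real m ^ Suc s \<le> (\<Prod>t\<in>S. real m + real (g t))"
      using power_increasing[of "Suc s" "card S" "real m"] assms elim by simp
    ultimately have "(\<Prod>i=1..s. real m + real i) / (\<Prod>t\<in>S. real m + real (g t))
        \<le> (real (Suc s) * real m) ^ s / real m ^ Suc s"
      using elim by (intro frac_le) (auto intro!: prod_nonneg)
    also have "\<dots> = real (Suc s) ^ s / real m"
      using elim by (simp add: power_mult_distrib)
    finally show ?case .
  qed
qed (auto intro!: always_eventually divide_nonneg_nonneg prod_nonneg)

text \<open>Numerator factors are multiplied in one at a time; as long as their number stays below
  \<open>card S\<close>, the product vanishes at infinity, as \<open>has_pf_mult_linear\<close>
  requires.\<close>

lemma has_pf_rational_fun:
  assumes "finite S" "\<And>s. s \<in> S \<Longrightarrow> g s \<in> {1..M}" "s < card S"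
  shows "has_pf M (\<lambda>j. card {s\<in>S. g s = j})
    (\<lambda>x. (\<Prod>i=1..s. x + real i) / (\<Prod>s\<in>S. x + real (g s)))"
  using assms(3)
proof (induction s)
  case 0
  then have "S \<noteq> {}" by auto
  then show ?case using has_pf_inverse_prod[OF assms(1) _ assms(2)] by simp
next
  case (Suc s)
  have "has_pf M (\<lambda>j. card {s\<in>S. g s = j})
    (\<lambda>x. (x + real (Suc s)) * ((\<Prod>i=1..s. x + real i) / (\<Prod>s\<in>S. x + real (g s))))"
    using rational_fun_tendsto_0[OF assms(1) Suc.prems, of g] Suc
    by (intro has_pf_mult_linear) (auto simp: mult_ac)
  then show ?case by (simp add: mult.commute)
qed

text \<open>The sum of the residues is the limit of \<open>m * f m\<close>. Its vanishing lets the
  simple poles be summed in \<open>pfsum_sums\<close>.\<close>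

lemma residue_sum_eq_0:
  assumes "(\<lambda>m. real m * f (real m)) \<longlonglongrightarrow> 0" "\<And>j k. e j < k \<Longrightarrow> c j k = 0"
    and "\<And>x. (\<forall>j\<in>{1..M}. x + real j \<noteq> 0) \<Longrightarrow> f x = pfsum M e c x"
  shows "(\<Sum>j=1..M. c j 1) = 0"
proof -
  define d where "d = (\<lambda>j k. c j k * (0 - real j) + c j (Suc k))"
  have eq: "real m * f (real m) = pfsum M e d (real m) + (\<Sum>j=1..M. c j 1)" for m
  proof -
    have "\<forall>j\<in>{1..M}. real m + real j \<noteq> 0" by auto
    then show ?thesis
      using pfsum_mult_linear[of M "real m" e c 0] assms(2) assms(3)[of "real m"]
      by (simp add: d_def)
  qed
  have "(\<lambda>m. pfsum M e d (real m) + (\<Sum>j=1..M. c j 1)) \<longlonglongrightarrow> 0"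
    using assms(1) unfolding eq .
  moreover have "(\<lambda>m. pfsum M e d (real m) + (\<Sum>j=1..M. c j 1)) \<longlonglongrightarrow> 0 + (\<Sum>j=1..M. c j 1)"
    by (intro tendsto_intros pfsum_tendsto_0)
  ultimately show ?thesis using LIMSEQ_unique by fastforce
qed

section \<open>Summation to zeta values\<close>

lemma zeta_sums:
  assumes "k \<ge> 2"
  shows "(\<lambda>m. 1 / real (Suc m) ^ k) sums zeta k"
proof -
  have "summable (\<lambda>m. 1 / real (Suc m) ^ k)"
    using inverse_power_summable[of k, where 'a = real] assms
    by (subst summable_Suc_iff) (simp add: inverse_eq_divide)
  then show ?thesis unfolding zeta_def by (rule summable_sums)
qed

lemma hurwitz_sums:
  assumes "k \<ge> 2" "j \<ge> 1"
  shows "(\<lambda>m. 1 / (real m + real j) ^ k) sums (zeta k - (\<Sum>i=1..<j. 1 / real i ^ k))"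
proof -
  have "(\<lambda>m. 1 / real (Suc (m + (j - 1))) ^ k) sums (zeta k - (\<Sum>i<j - 1. 1 / real (Suc i) ^ k))"
    using sums_split_initial_segment[OF zeta_sums[OF assms(1)], of "j - 1"] by simp
  moreover have "(\<Sum>i<j - 1. 1 / real (Suc i) ^ k) = (\<Sum>i=1..<j. 1 / real i ^ k)"
    using assms(2) by (intro sum.reindex_bij_witness[of _ "\<lambda>i. i - 1" Suc]) auto
  moreover have "real (Suc (m + (j - 1))) = real m + real j" for m
    using assms(2) by linarith
  ultimately show ?thesis by simp
qed

lemma harmonic_diff_sums:
  assumes "j \<ge> 1"
  shows "(\<lambda>m. 1 / (real m + real j) - 1 / (real m + 1)) sums (- (\<Sum>i=1..<j. 1 / real i))"
  using assms
proof (induction j rule: dec_induct)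
  case (step j)
  have "(\<lambda>m. 1 / (real m + real j)) \<longlonglongrightarrow> 0"
    using LIMSEQ_ignore_initial_segment[OF lim_1_over_n, of j] by simp
  from sums_add[OF step.IH telescope_sums[OF this]] step.hyps
  show ?case by (simp add: algebra_simps)
qed auto

text \<open>The simple poles are summed after subtracting \<open>1 / (m + 1)\<close> from each of them, which changes
  nothing because the residues add up to zero.\<close>

lemma pfsum_sums:
  assumes "n \<ge> 1" "(\<Sum>j=1..M. c j 1) = 0"
  shows "(\<lambda>m. pfsum M (\<lambda>_. n) c (real m)) sums
    (- (\<Sum>j=1..M. \<Sum>k=1..n. c j k * (\<Sum>i=1..<j. 1 / real i ^ k)) + (\<Sum>k=2..n. (\<Sum>j=1..M. c j k) * zeta k))"
proof -
  \<comment> \<open>\<open>t\<close> and \<open>z\<close> let all orders be handled in one sum: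
    order 1 gets the counterterm and no zeta value, higher orders the reverse.\<close>
  define t where "t = (\<lambda>(k::nat) x. if k = 1 then 1 / (x + 1) else (0::real))"
  define z where "z = (\<lambda>(k::nat). if k = 1 then 0 else zeta k)"
  have "(\<lambda>m. \<Sum>j=1..M. \<Sum>k=1..n. c j k * (1 / (real m + real j) ^ k - t k (real m))) sums
     (\<Sum>j=1..M. \<Sum>k=1..n. c j k * (z k - (\<Sum>i=1..<j. 1 / real i ^ k)))"
  proof (intro sums_sum sums_mult)
    fix j k assume jk: "j \<in> {1..M}" "k \<in> {1..n}"
    show "(\<lambda>m. 1 / (real m + real j) ^ k - t k (real m)) sums (z k - (\<Sum>i=1..<j. 1 / real i ^ k))"
    proof (cases "k = 1")
      case True
      then show ?thesis using harmonic_diff_sums[of j] jk by (simp add: t_def z_def)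
    next
      case False
      then show ?thesis using hurwitz_sums[of k j] jk by (simp add: t_def z_def)
    qed
  qed
  moreover have "(\<Sum>j=1..M. \<Sum>k=1..n. c j k * (1 / (x + real j) ^ k - t k x)) = pfsum M (\<lambda>_. n) c x" for x
  proof -
    have "(\<Sum>k=1..n. c j k * t k x) = c j 1 * (1 / (x + 1))" for j
    proof -
      have "(\<Sum>k=1..n. c j k * t k x) = (\<Sum>k=1..n. if k = 1 then c j 1 * (1 / (x + 1)) else 0)"
        by (intro sum.cong) (auto simp: t_def)
      then show ?thesis using assms(1) by (simp add: sum.delta)
    qed
    then have "(\<Sum>j=1..M. \<Sum>k=1..n. c j k * t k x) = (\<Sum>j=1..M. c j 1) * (1 / (x + 1))"
      by (simp only: sum_distrib_right)
    then show ?thesis using assms(2)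
      by (simp add: pfsum_def right_diff_distrib sum_subtractf)
  qed
  moreover have "(\<Sum>j=1..M. \<Sum>k=1..n. c j k * (z k - (\<Sum>i=1..<j. 1 / real i ^ k)))
     = - (\<Sum>j=1..M. \<Sum>k=1..n. c j k * (\<Sum>i=1..<j. 1 / real i ^ k)) + (\<Sum>k=2..n. (\<Sum>j=1..M. c j k) * zeta k)"
  proof -
    have "(\<Sum>k=1..n. c j k * z k) = (\<Sum>k=2..n. c j k * zeta k)" for j
      using assms(1) by (intro sum.mono_neutral_cong_right) (auto simp: z_def)
    then have "(\<Sum>j=1..M. \<Sum>k=1..n. c j k * z k) = (\<Sum>k=2..n. (\<Sum>j=1..M. c j k) * zeta k)"
      by (simp only: sum_distrib_right) (rule sum.swap)
    then show ?thesis by (simp add: right_diff_distrib sum_subtractf)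
  qed
  ultimately show ?thesis by simp
qed

section \<open>Reflection symmetry of the coefficients\<close>

text \<open>The reflection exchanges the poles \<open>-j\<close> and \<open>-(M + 1 - j)\<close> and
  turns each linear factor into the negative of its mirror image, whence the sign
  \<open>(- 1) ^ k\<close>.\<close>

lemma pfsum_reflect:
  "pfsum M e c (- x - real (Suc M)) =
   pfsum M (\<lambda>j. e (Suc M - j)) (\<lambda>j k. (- 1) ^ k * c (Suc M - j) k) x"
  unfolding pfsum_def
proof (rule sum.reindex_bij_witness[of _ "\<lambda>j. Suc M - j" "\<lambda>j. Suc M - j"])
  fix j assume j: "j \<in> {1..M}"
  then have "- x - real (Suc M) + real j = - (x + real (Suc M - j))"
    by (simp add: of_nat_diff)
  then have eq: "(- x - real (Suc M) + real j) ^ k = (- 1) ^ k * (x + real (Suc M - j)) ^ k" for k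
    by (metis power_minus)
  have "a / ((- 1) ^ k * y) = (- 1) ^ k * a / y" for a y :: real and k
    by (cases "even k") auto
  then show "(\<Sum>k=1..e (Suc M - (Suc M - j)). (- 1) ^ k * c (Suc M - (Suc M - j)) k / (x + real (Suc M - j)) ^ k)
      = (\<Sum>k=1..e j. c j k / (- x - real (Suc M) + real j) ^ k)"
    using j unfolding eq by simp
qed auto

text \<open>Averaging an arbitrary expansion with its reflection makes the coefficients symmetric
  without an appeal to uniqueness of partial fractions. When
  \<open>\<epsilon> * (- 1) ^ k = - 1\<close>, the new coefficients of order \<open>k\<close> are
  antisymmetric under \<open>j \<mapsto> M + 1 - j\<close> and cancel in the sum.\<close>

lemma has_pf_symmetric:
  assumes "has_pf M (\<lambda>_. n) f" "\<epsilon> \<in> {- 1, 1}" "\<And>x. f (- x - real (Suc M)) = \<epsilon> * f x"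
  obtains c where "\<And>j k. c j k \<in> \<rat>" "\<And>j k. n < k \<Longrightarrow> c j k = 0"
    "\<And>x. \<forall>j\<in>{1..M}. x + real j \<noteq> 0 \<Longrightarrow> f x = pfsum M (\<lambda>_. n) c x"
    "\<And>k. \<epsilon> * (- 1) ^ k = - 1 \<Longrightarrow> (\<Sum>j=1..M. c j k) = 0"
proof -
  obtain c where c: "\<And>j k. c j k \<in> \<rat>" "\<And>j k. n < k \<Longrightarrow> c j k = 0"
    "\<And>x. (\<forall>j\<in>{1..M}. x + real j \<noteq> 0) \<Longrightarrow> f x = pfsum M (\<lambda>_. n) c x"
    using assms(1) unfolding has_pf_def by auto
  define d where "d = (\<lambda>j k. (c j k + \<epsilon> * ((- 1) ^ k * c (Suc M - j) k)) / 2)"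
  show thesis
  proof (rule that[of d])
    show "d j k \<in> \<rat>" for j k using c(1) assms(2) by (auto simp: d_def)
    show "n < k \<Longrightarrow> d j k = 0" for j k using c(2) by (auto simp: d_def)
    fix x assume x: "\<forall>j\<in>{1..M}. x + real j \<noteq> 0"
    have "\<forall>j\<in>{1..M}. (- x - real (Suc M)) + real j \<noteq> 0"
    proof
      fix j assume "j \<in> {1..M}"
      then have "Suc M - j \<in> {1..M}" by auto
      with x have "x + real (Suc M - j) \<noteq> 0" by blast
      moreover have "real (Suc M - j) = real (Suc M) - real j"
        using \<open>j \<in> {1..M}\<close> by (auto simp: of_nat_diff)
      ultimately show "(- x - real (Suc M)) + real j \<noteq> 0" by linarith
    qed
    from c(3)[OF this] have "\<epsilon> * f x = pfsum M (\<lambda>_. n) (\<lambda>j k. (- 1) ^ k * c (Suc M - j) k) x"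
      unfolding assms(3) pfsum_reflect .
    then have "f x = \<epsilon> * pfsum M (\<lambda>_. n) (\<lambda>j k. (- 1) ^ k * c (Suc M - j) k) x"
      using assms(2) by auto
    moreover have "pfsum M (\<lambda>_. n) d x = (pfsum M (\<lambda>_. n) c x
        + \<epsilon> * pfsum M (\<lambda>_. n) (\<lambda>j k. (- 1) ^ k * c (Suc M - j) k) x) / 2"
      by (simp add: d_def pfsum_def sum_distrib_left sum_divide_distrib sum.distrib[symmetric]
          add_divide_distrib mult.commute)
    ultimately show "f x = pfsum M (\<lambda>_. n) d x" using c(3)[OF x] by simp
  next
    fix k assume "\<epsilon> * (- 1) ^ k = - 1"
    then have d: "d j k = (c j k - c (Suc M - j) k) / 2" for j
      by (simp add: d_def mult.assoc[symmetric])
    have "(\<Sum>j=1..M. c (Suc M - j) k) = (\<Sum>j=1..M. c j k)"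
      by (rule sum.reindex_bij_witness[of _ "\<lambda>j. Suc M - j" "\<lambda>j. Suc M - j"]) auto
    then show "(\<Sum>j=1..M. d j k) = 0"
      by (simp add: d sum_divide_distrib[symmetric] sum_subtractf)
  qed
qed

section \<open>Term-by-term integration\<close>

text \<open>The value is \<open>B(p + 1, q + 1)\<close> with \<open>p!\<close> cancelled, which
  leaves a product of linear factors in \<open>p\<close>. Since
  \<open>(1 - x) ^ Suc q = (1 - x) ^ q - x * (1 - x) ^ q\<close>, the induction on \<open>q\<close>
  keeps \<open>p\<close> arbitrary.\<close>

lemma has_bochner_integral_beta:
  "has_bochner_integral lborel (\<lambda>x::real. indicator {0..1} x * (x ^ p * (1 - x) ^ q))
     (fact q / (\<Prod>j=Suc p..Suc (p + q). real j))"
proof (induction q arbitrary: p)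
  case 0
  have "has_bochner_integral lborel (\<lambda>x::real. x ^ p * indicator {0..1} x)
      (\<integral>x. x ^ p * indicator {0..1} x \<partial>lborel)"
  proof (rule has_bochner_integral_integrable)
    show "integrable lborel (\<lambda>x::real. x ^ p * indicator {0..1} x)"
      by (intro borel_integrable_atLeastAtMost continuous_intros)
  qed
  then show ?case using integral_power[of 0 1 p] by (simp add: mult.commute)
next
  case (Suc q)
  define P where "P = (\<Prod>j=Suc p..Suc (p + q). real j)"
  have P: "P \<noteq> 0" by (simp add: P_def)
  have P1: "(\<Prod>j=Suc p..Suc (p + Suc q). real j) = P * real (p + q + 2)"
    by (simp add: P_def)
  \<comment> \<open>Shifting the range by one drops the factor \<open>p + 1\<close> and gains
    \<open>p + q + 2\<close>.\<close>
  have P2: "(\<Prod>j=Suc (Suc p)..Suc (Suc p + q). real j) = P * real (p + q + 2) / real (Suc p)"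
  proof -
    have "(\<Prod>j=Suc p..Suc (Suc p + q). real j) = real (Suc p) * (\<Prod>j=Suc (Suc p)..Suc (Suc p + q). real j)"
      by (rule prod.atLeast_Suc_atMost) simp
    then show ?thesis using P1 by (simp add: field_simps)
  qed
  have "has_bochner_integral lborel
     (\<lambda>x::real. indicator {0..1} x * (x ^ p * (1 - x) ^ q) - indicator {0..1} x * (x ^ Suc p * (1 - x) ^ q))
     (fact q / P - fact q / (P * real (p + q + 2) / real (Suc p)))"
    unfolding P2[symmetric] unfolding P_def
    by (intro has_bochner_integral_diff Suc.IH)
  moreover have "fact q / P - fact q / (P * real (p + q + 2) / real (Suc p))
      = fact (Suc q) / (\<Prod>j=Suc p..Suc (p + Suc q). real j)"
  proof -
    define w where "w = real (p + q + 2)"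
    have w: "w = real (Suc p) + real (Suc q)" "w \<noteq> 0" by (simp_all add: w_def)
    have "fact q / P - fact q / (P * w / real (Suc p)) = fact q * w / (P * w) - fact q * real (Suc p) / (P * w)"
      using w(2) by simp
    also have "\<dots> = fact q * (w - real (Suc p)) / (P * w)"
      by (simp only: diff_divide_distrib right_diff_distrib)
    also have "\<dots> = fact (Suc q) / (P * w)" by (simp add: w(1) mult.commute)
    finally show ?thesis unfolding P1 w_def .
  qed
  moreover have "(\<lambda>x::real. indicator {0..1} x * (x ^ p * (1 - x) ^ q) - indicator {0..1} x * (x ^ Suc p * (1 - x) ^ q))
     = (\<lambda>x. indicator {0..1} x * (x ^ p * (1 - x) ^ Suc q))"
    by (auto simp: algebra_simps)
  ultimately show ?case by simp
qed

lemma has_bochner_integral_beta_shift: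
  assumes "u \<ge> 1" "v \<ge> 1"
  shows "has_bochner_integral lborel (\<lambda>x::real. indicator {0..1} x * (x ^ (m + (u - 1)) * (1 - x) ^ (v - 1)))
     (fact (v - 1) / (\<Prod>j\<in>{u..<u + v}. real m + real j))"
proof -
  have "(\<Prod>j=Suc (m + (u - 1))..Suc (m + (u - 1) + (v - 1)). real j) = (\<Prod>j\<in>{u..<u + v}. real m + real j)"
    using assms by (intro prod.reindex_bij_witness[of _ "\<lambda>j. m + j" "\<lambda>j. j - m"]) auto
  then show ?thesis using has_bochner_integral_beta[of "m + (u - 1)" "v - 1"] by simp
qed

section \<open>Series expansion of the integrand and interchange with the integral\<close>

text \<open>The binomial series at exponent \<open>-N\<close>. For \<open>N = 0\<close> truncated
  subtraction still gives the right coefficients: \<open>0 choose 0 = 1\<close> at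
  \<open>m = 0\<close>, and \<open>m - 1 choose m = 0\<close> afterwards.\<close>

lemma negative_binomial_sums:
  fixes z :: real
  assumes "\<bar>z\<bar> < 1"
  shows "(\<lambda>m. real (m + N - 1 choose m) * z ^ m) sums (1 / (1 - z) ^ N)"
proof -
  have "(- real N gchoose m) * (- z) ^ m = real (m + N - 1 choose m) * z ^ m" for m
  proof (cases "m + N")
    case (Suc k)
    then have "real N + real m - 1 = real (m + N - 1)" by simp
    then have "(- real N gchoose m) = (- 1) ^ m * real (m + N - 1 choose m)"
      unfolding gbinomial_minus binomial_gbinomial by simp
    then show ?thesis by (simp add: power_minus[of z])
  qed auto
  moreover have "(1 - z) powr (- real N) = 1 / (1 - z) ^ N"
    using assms by (simp add: powr_minus powr_realpow inverse_eq_divide)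
  ultimately show ?thesis using gen_binomial_real[of "- z" "- real N"] assms by simp
qed

text \<open>The hyperplane is a box with one side a single point, hence null. In the cube the
  product of the coordinates is 1 only where \<open>x 1 = 1\<close>, so this disposes of the
  singularity.\<close>

lemma AE_lebesgue_pow_component_neq:
  assumes "i \<in> {1..n}"
  shows "AE x in lebesgue_pow n. x i \<noteq> a"
proof -
  interpret product_sigma_finite "\<lambda>_::nat. lborel :: real measure" ..
  let ?A = "\<Pi>\<^sub>E k\<in>{1..n}. if k = i then {a} else UNIV"
  have "emeasure (lebesgue_pow n) ?A = (\<Prod>k=1..n. emeasure lborel (if k = i then {a} else UNIV))"
    unfolding lebesgue_pow_def by (intro emeasure_PiM) auto
  also have "\<dots> = 0" using assms by (intro prod_zero) auto
  finally have "?A \<in> null_sets (lebesgue_pow n)"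
    by (auto simp: lebesgue_pow_def intro!: sets_PiM_I_finite)
  moreover have "{x \<in> space (lebesgue_pow n). \<not> x i \<noteq> a} \<subseteq> ?A"
    by (auto simp: lebesgue_pow_def space_PiM PiE_def)
  ultimately show ?thesis by (rule AE_I')
qed

text \<open>All terms of the expansion are nonnegative, so summability of their integrals
  \<open>R\<close> gives both absolute convergence and the interchange of sum and integral.\<close>

lemma integrand_integral:
  fixes n N :: nat and u v :: "nat \<Rightarrow> nat"
  defines "R \<equiv> \<lambda>m. real (m + N - 1 choose m) *
      (\<Prod>i=1..n. fact (v i - 1) / (\<Prod>j\<in>{u i..<u i + v i}. real m + real j))"
  assumes n: "n \<ge> 1" and u: "\<forall>i\<in>{1..n}. u i \<ge> 1" and v: "\<forall>i\<in>{1..n}. v i \<ge> 1"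
    and R: "summable R"
  shows "set_integrable (lebesgue_pow n) (unit_cube n) (integrand n u v N)"
    and "(LINT x:unit_cube n|lebesgue_pow n. integrand n u v N x) = suminf R"
proof -
  interpret product_sigma_finite "\<lambda>_::nat. lborel :: real measure" ..
  \<comment> \<open>The indicator of the cube is split among the coordinates, so that each term is a
    product of one-variable functions.\<close>
  define h where "h = (\<lambda>m i x. indicator {0..1} x * (x ^ (m + (u i - 1)) * (1 - x) ^ (v i - 1)) :: real)"
  define F where "F = (\<lambda>m x. real (m + N - 1 choose m) * (\<Prod>i=1..n. h m i (x i)))"
  have h: "has_bochner_integral lborel (h m i)
      (fact (v i - 1) / (\<Prod>j\<in>{u i..<u i + v i}. real m + real j))" if "i \<in> {1..n}" for m i
    unfolding h_def using that u v by (intro has_bochner_integral_beta_shift) auto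
  have F_int: "integrable (lebesgue_pow n) (F m)" for m
    unfolding F_def lebesgue_pow_def
    by (intro integrable_mult_right product_integrable_prod) (use h in \<open>auto simp: has_bochner_integral_iff\<close>)
  have F_integral: "integral\<^sup>L (lebesgue_pow n) (F m) = R m" for m
  proof -
    have "(\<integral>x. (\<Prod>i=1..n. h m i (x i)) \<partial>lebesgue_pow n) = (\<Prod>i=1..n. integral\<^sup>L lborel (h m i))"
      unfolding lebesgue_pow_def
      by (intro product_integral_prod) (use h in \<open>auto simp: has_bochner_integral_iff\<close>)
    also have "\<dots> = (\<Prod>i=1..n. fact (v i - 1) / (\<Prod>j\<in>{u i..<u i + v i}. real m + real j))"
      by (intro prod.cong refl) (use h in \<open>auto simp: has_bochner_integral_iff\<close>)
    finally show ?thesis by (simp add: F_def R_def)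
  qed
  have F_nonneg: "F m x \<ge> 0" for m x
  proof -
    have "h m i y \<ge> 0" for i y
      by (cases "y \<in> {0..1}") (auto simp: h_def)
    then show ?thesis by (auto simp: F_def intro!: mult_nonneg_nonneg prod_nonneg)
  qed
  have one: "1 \<in> {1..n}" using n by simp
  have F_sums: "AE x in lebesgue_pow n. (\<lambda>m. F m x) sums (indicator (unit_cube n) x *\<^sub>R integrand n u v N x)"
    using AE_lebesgue_pow_component_neq[OF one, of 1] AE_space
  proof eventually_elim
    case (elim x)
    show ?case
    proof (cases "x \<in> unit_cube n")
      case False
      \<comment> \<open>Points of the product space are extensional, so a point outside the cube has
        a coordinate outside \<open>[0,1]\<close>, and every \<open>F m\<close> vanishes
        there.\<close>
      moreover have "x \<in> extensional {1..n}"
        using elim by (auto simp: lebesgue_pow_def space_PiM PiE_def)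
      ultimately obtain i where "i \<in> {1..n}" "x i \<notin> {0..1}"
        unfolding unit_cube_def PiE_iff by blast
      then have "h m i (x i) = 0" for m by (simp add: h_def indicator_def)
      with \<open>i \<in> {1..n}\<close> have "(\<Prod>i=1..n. h m i (x i)) = 0" for m
        by (intro prod_zero finite_atLeastAtMost bexI)
      then have "F m x = 0" for m by (simp add: F_def)
      then show ?thesis using \<open>x \<notin> unit_cube n\<close> by simp
    next
      case True
      then have x: "x i \<in> {0..1}" if "i \<in> {1..n}" for i using that by (auto simp: unit_cube_def)
      define X where "X = (\<Prod>i=1..n. x i)"
      have "X = x 1 * (\<Prod>i=Suc 1..n. x i)"
        unfolding X_def by (rule prod.atLeast_Suc_atMost) (use n in simp)
      also have "\<dots> \<le> x 1 * 1"
        using x n by (intro mult_left_mono prod_le_1) auto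
      also have "\<dots> < 1" using x[of 1] n elim by auto
      finally have "X < 1" .
      moreover have "X \<ge> 0" unfolding X_def using x by (intro prod_nonneg) auto
      ultimately have "\<bar>X\<bar> < 1" by simp
      define Y where "Y = (\<Prod>i=1..n. x i ^ (u i - 1)) * (\<Prod>i=1..n. (1 - x i) ^ (v i - 1))"
      have "F m x = Y * (real (m + N - 1 choose m) * X ^ m)" for m
      proof -
        have "(\<Prod>i=1..n. h m i (x i)) = (\<Prod>i=1..n. x i ^ m * (x i ^ (u i - 1) * (1 - x i) ^ (v i - 1)))"
          using x by (intro prod.cong) (auto simp: h_def power_add)
        also have "\<dots> = X ^ m * Y"
          by (simp add: prod.distrib X_def Y_def prod_power_distrib)
        finally show ?thesis by (simp add: F_def)
      qed
      moreover have "indicator (unit_cube n) x *\<^sub>R integrand n u v N x = Y * (1 / (1 - X) ^ N)"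
        using True by (simp add: integrand_def X_def Y_def)
      ultimately show ?thesis
        using sums_mult[OF negative_binomial_sums[OF \<open>\<bar>X\<bar> < 1\<close>], of Y N] by simp
    qed
  qed
  have *: "AE x in lebesgue_pow n. summable (\<lambda>m. norm (F m x))"
    using F_sums by eventually_elim (simp add: F_nonneg sums_summable)
  have **: "summable (\<lambda>m. \<integral>x. norm (F m x) \<partial>lebesgue_pow n)"
    using R by (simp add: F_nonneg F_integral)
  have ae: "AE x in lebesgue_pow n. (\<Sum>m. F m x) = indicator (unit_cube n) x *\<^sub>R integrand n u v N x"
    using F_sums by eventually_elim (simp add: sums_iff)
  have meas: "(\<lambda>x. indicator (unit_cube n) x *\<^sub>R integrand n u v N x) \<in> borel_measurable (lebesgue_pow n)"
    unfolding integrand_def unit_cube_def lebesgue_pow_def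
    by measurable
  have meas': "(\<lambda>x. \<Sum>m. F m x) \<in> borel_measurable (lebesgue_pow n)"
    using integrable_suminf[OF F_int * **] by auto
  show "set_integrable (lebesgue_pow n) (unit_cube n) (integrand n u v N)"
    unfolding set_integrable_def
    using integrable_suminf[OF F_int * **] integrable_cong_AE[OF meas' meas ae] by simp
  show "(LINT x:unit_cube n|lebesgue_pow n. integrand n u v N x) = suminf R"
    unfolding set_lebesgue_integral_def
    using integral_suminf[OF F_int * **] integral_cong_AE[OF meas' meas ae]
    by (simp add: F_integral)
qed

section \<open>The rational summand\<close>

lemma fact_in_Rats: "(fact k :: 'a :: field_char_0) \<in> \<rat>"
  by (metis Rats_of_nat of_nat_fact)

lemma minus_one_power_cases: "(- 1 :: 'a :: ring_1) ^ k \<in> {- 1, 1}"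
  by (cases "even k") auto

lemma binomial_eq_prod:
  "real (m + s choose m) = (\<Prod>i=1..s. real m + real i) / fact s"
proof -
  have "(\<Prod>i=1..s. real m + real i) * fact m = fact (m + s)"
  proof (induction s)
    case (Suc s)
    have "(\<Prod>i=1..Suc s. real m + real i) * fact m
        = ((\<Prod>i=1..s. real m + real i) * fact m) * real (Suc (m + s))"
      by simp
    also have "\<dots> = fact (m + Suc s)"
      unfolding Suc by (simp add: mult.commute)
    finally show ?case .
  qed simp
  then show ?thesis by (simp add: binomial_fact field_simps)
qed

lemma prod_linear_reflect:
  assumes "\<And>j. j \<in> A \<Longrightarrow> j \<le> N \<and> N - j \<in> A"
  shows "(\<Prod>j\<in>A. - x - real N + real j) = (- 1) ^ card A * (\<Prod>j\<in>A. x + real j)"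
proof -
  have "(\<Prod>j\<in>A. - x - real N + real j) = (\<Prod>j\<in>A. - 1 * (x + real j))"
  proof (rule prod.reindex_bij_witness[of _ "\<lambda>j. N - j" "\<lambda>j. N - j"])
    fix j assume "j \<in> A"
    then show "- 1 * (x + real (N - j)) = - x - real N + real j"
      using assms[of j] by (simp add: of_nat_diff)
  qed (use assms in auto)
  then show ?thesis by (simp only: prod.distrib prod_constant)
qed

text \<open>By \<open>2 * u i + v i = N + 1\<close> the end points \<open>u i\<close> and
  \<open>u i + v i - 1\<close> of each range add up to \<open>N\<close>, so
  \<open>j \<mapsto> N - j\<close> permutes the range; moreover \<open>v i\<close> has the parity of
  \<open>N + 1\<close>. Thus each of the \<open>n\<close> denominator products, and the numerator
  with its \<open>N - 1\<close> factors, contributes the sign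
  \<open>(- 1) ^ (N + 1)\<close>.\<close>

lemma summand_reflect:
  fixes n N :: nat and u v :: "nat \<Rightarrow> nat"
  defines "f \<equiv> \<lambda>x. (\<Prod>i=1..N - 1. x + real i) / (\<Prod>i=1..n. \<Prod>j\<in>{u i..<u i + v i}. x + real j)"
  assumes "N \<ge> 1" "\<And>i. i \<in> {1..n} \<Longrightarrow> 2 * u i + v i = N + 1"
  shows "f (- x - real N) = (- 1) ^ ((n + 1) * (N + 1)) * f x"
proof -
  have "(\<Prod>j\<in>{u i..<u i + v i}. - x - real N + real j) =
      (- 1) ^ (N + 1) * (\<Prod>j\<in>{u i..<u i + v i}. x + real j)" if "i \<in> {1..n}" for i
  proof -
    have "(- 1 :: real) ^ v i = (- 1) ^ (N + 1)"
      unfolding assms(3)[OF that, symmetric] by (simp add: power_add power_mult)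
    moreover have "j \<in> {u i..<u i + v i} \<Longrightarrow> j \<le> N \<and> N - j \<in> {u i..<u i + v i}" for j
      using assms(3)[OF that] by auto
    ultimately show ?thesis using prod_linear_reflect[of "{u i..<u i + v i}" N x] by simp
  qed
  then have "(\<Prod>i=1..n. \<Prod>j\<in>{u i..<u i + v i}. - x - real N + real j) =
      (\<Prod>i=1..n. (- 1) ^ (N + 1) * (\<Prod>j\<in>{u i..<u i + v i}. x + real j))"
    by (rule prod.cong[OF refl])
  also have "\<dots> = (- 1) ^ ((N + 1) * n) * (\<Prod>i=1..n. \<Prod>j\<in>{u i..<u i + v i}. x + real j)"
    unfolding prod.distrib prod_constant power_mult by simp
  finally have "(\<Prod>i=1..n. \<Prod>j\<in>{u i..<u i + v i}. - x - real N + real j) =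
      (- 1) ^ ((N + 1) * n) * (\<Prod>i=1..n. \<Prod>j\<in>{u i..<u i + v i}. x + real j)" .
  moreover have "(\<Prod>i=1..N - 1. - x - real N + real i) = (- 1) ^ (N + 1) * (\<Prod>i=1..N - 1. x + real i)"
  proof -
    have "i \<in> {1..N - 1} \<Longrightarrow> i \<le> N \<and> N - i \<in> {1..N - 1}" for i by auto
    from prod_linear_reflect[OF this, where x = x]
    have "(\<Prod>i=1..N - 1. - x - real N + real i) = (- 1) ^ (N - 1) * (\<Prod>i=1..N - 1. x + real i)"
      by simp
    also have "(- 1 :: real) ^ (N - 1) = (- 1) ^ (N + 1)"
      using assms(2) by (cases N) auto
    finally show ?thesis .
  qed
  \<comment> \<open>A sign moves from denominator to numerator even when \<open>q = 0\<close>, so no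
    poles have to be excluded.\<close>
  moreover have "t * p / (s * q) = t * s * (p / q)" if "s \<in> {- 1, 1}" for s t p q :: real
    using that by auto
  moreover have "(- 1 :: real) ^ ((N + 1) * n) \<in> {- 1, 1}"
    by (rule minus_one_power_cases)
  moreover have "(- 1 :: real) ^ (N + 1) * (- 1) ^ ((N + 1) * n) = (- 1) ^ ((n + 1) * (N + 1))"
    unfolding power_add[symmetric] by (rule arg_cong[where f = "power (- 1)"]) (simp add: algebra_simps)
  ultimately show ?thesis unfolding f_def by presburger
qed

section \<open>Evaluation of the series\<close>

lemma summand_sums:
  fixes n N :: nat and u v :: "nat \<Rightarrow> nat"
  assumes n: "n \<ge> 1" and N: "N \<ge> 1" and u: "\<forall>i\<in>{1..n}. u i \<ge> 1"
    and v: "(\<Sum>i=1..n. v i) \<ge> N + 1"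
  obtains a :: "nat \<Rightarrow> real" where "\<And>k. a k \<in> \<rat>"
    "(\<lambda>m. (\<Prod>i=1..N - 1. real m + real i) / (\<Prod>i=1..n. \<Prod>j\<in>{u i..<u i + v i}. real m + real j))
       sums (a 0 + (\<Sum>k=2..n. a k * zeta k))"
    "\<And>k. \<lbrakk>\<forall>i\<in>{1..n}. v i \<ge> 1 \<and> 2 * u i + v i = N + 1; k \<ge> 1; odd ((n + 1) * (N + 1) + k)\<rbrakk> \<Longrightarrow> a k = 0"
proof -
  \<comment> \<open>\<open>S\<close> lists the linear factors of the denominator with multiplicity;
    a given \<open>j\<close> occurs at most once for each \<open>i\<close>, so no pole has order
    above \<open>n\<close>.\<close>
  define S where "S = (SIGMA i:{1..n}. {u i..<u i + v i})"
  define f where "f = (\<lambda>x. (\<Prod>i=1..N - 1. x + real i) / (\<Prod>i=1..n. \<Prod>j\<in>{u i..<u i + v i}. x + real j))"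
  define sym where "sym \<longleftrightarrow> (\<forall>i\<in>{1..n}. v i \<ge> 1 \<and> 2 * u i + v i = N + 1)"
  \<comment> \<open>In the symmetric case all poles lie among \<open>-1\<close>, ...,
    \<open>-(N - 1)\<close>, and \<open>Suc M = N\<close> makes the reflection that of
    \<open>summand_reflect\<close>. Otherwise any upper bound for the \<open>j\<close> will
    do.\<close>
  define M where "M = (if sym then N - 1 else (\<Sum>i=1..n. u i + v i))"
  have S: "finite S" "card S = (\<Sum>i=1..n. v i)" by (simp_all add: S_def)
  have f: "f = (\<lambda>x. (\<Prod>i=1..N - 1. x + real i) / (\<Prod>s\<in>S. x + real (snd s)))"
    by (simp add: f_def S_def prod.Sigma split_beta)
  have SM: "snd s \<in> {1..M}" if s: "s \<in> S" for s
  proof -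
    obtain i j where ij: "s = (i, j)" "i \<in> {1..n}" "u i \<le> j" "j < u i + v i"
      using s by (auto simp: S_def)
    have "u i + v i \<le> (\<Sum>i=1..n. u i + v i)"
      by (rule member_le_sum[OF ij(2)]) auto
    moreover have "2 * u i + v i = N + 1" if sym
      using that ij(2) by (simp add: sym_def)
    ultimately show ?thesis using ij bspec[OF u ij(2)] by (auto simp: M_def)
  qed
  have order: "card {s\<in>S. snd s = j} \<le> n" for j
  proof -
    have "card {s\<in>S. snd s = j} \<le> card {1..n}"
      by (rule card_inj_on_le[of fst]) (auto simp: inj_on_def S_def)
    then show ?thesis by simp
  qed
  have pf: "has_pf M (\<lambda>_. n) f"
    unfolding f by (rule has_pf_mono[OF has_pf_rational_fun[OF S(1) SM]]) (use order S(2) v in auto)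
  have lim: "(\<lambda>m. real m * f (real m)) \<longlonglongrightarrow> 0"
  proof -
    \<comment> \<open>\<open>m * f m = (m + N) * f m - N * f m\<close>, and the factor
      \<open>m + N\<close> extends the numerator to \<open>N\<close> factors, still fewer than
      \<open>card S\<close>.\<close>
    have "(\<lambda>m. (\<Prod>i=1..N. real m + real i) / (\<Prod>s\<in>S. real m + real (snd s)) - real N * f (real m)) \<longlonglongrightarrow> 0 - real N * 0"
      unfolding f by (intro tendsto_intros rational_fun_tendsto_0) (use S v in auto)
    moreover have "(\<Prod>i=1..N. x + real i) = (x + real N) * (\<Prod>i=1..N - 1. x + real i)" for x
      using N by (cases N) (auto simp: mult.commute)
    ultimately show ?thesis by (simp add: f algebra_simps add_divide_distrib)
  qed
  define \<epsilon> :: real where "\<epsilon> = (- 1) ^ ((n + 1) * (N + 1))"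
  obtain c where c: "\<And>j k. c j k \<in> \<rat>" "\<And>j k. n < k \<Longrightarrow> c j k = 0"
    "\<And>x. \<forall>j\<in>{1..M}. x + real j \<noteq> 0 \<Longrightarrow> f x = pfsum M (\<lambda>_. n) c x"
    "\<And>k. sym \<Longrightarrow> \<epsilon> * (- 1) ^ k = - 1 \<Longrightarrow> (\<Sum>j=1..M. c j k) = 0"
  proof (cases sym)
    case True
    then have "f (- x - real (Suc M)) = \<epsilon> * f x" for x
      using summand_reflect[of N n u v x] N by (simp add: f_def \<epsilon>_def M_def sym_def)
    moreover have "\<epsilon> \<in> {- 1, 1}" unfolding \<epsilon>_def by (rule minus_one_power_cases)
    ultimately show thesis using has_pf_symmetric[OF pf, of \<epsilon>] that by metis
  next
    case False
    then show thesis using pf that unfolding has_pf_def by metis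
  qed
  define a where "a = (\<lambda>k. if k = 0 then - (\<Sum>j=1..M. \<Sum>k=1..n. c j k * (\<Sum>i=1..<j. 1 / real i ^ k))
      else (\<Sum>j=1..M. c j k))"
  have res: "(\<Sum>j=1..M. c j 1) = 0"
    by (rule residue_sum_eq_0[OF lim, of "\<lambda>_. n"]) (use c in auto)
  have f_eq: "f (real m) = pfsum M (\<lambda>_. n) c (real m)" for m
    by (rule c(3)) auto
  have "(\<Sum>k=2..n. a k * zeta k) = (\<Sum>k=2..n. (\<Sum>j=1..M. c j k) * zeta k)"
    by (intro sum.cong) (auto simp: a_def)
  then have "(\<lambda>m. f (real m)) sums (a 0 + (\<Sum>k=2..n. a k * zeta k))"
    using pfsum_sums[OF n, of c M, OF res] unfolding f_eq by (simp add: a_def)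
  moreover have "a k \<in> \<rat>" for k
    using c(1) by (auto simp: a_def intro!: Rats_sum Rats_mult Rats_divide)
  moreover have "a k = 0" if "sym" "k \<ge> 1" "odd ((n + 1) * (N + 1) + k)" for k
  proof -
    have "\<epsilon> * (- 1) ^ k = - 1"
      unfolding \<epsilon>_def power_add[symmetric] using that(3) by (rule neg_one_odd_power)
    then show ?thesis using c(4) that by (auto simp: a_def)
  qed
  ultimately show thesis using that[of a] unfolding f_def sym_def by blast
qed

lemma integral_sums:
  fixes n N :: nat and u v :: "nat \<Rightarrow> nat"
  defines "R \<equiv> \<lambda>m. real (m + N - 1 choose m) *
      (\<Prod>i=1..n. fact (v i - 1) / (\<Prod>j\<in>{u i..<u i + v i}. real m + real j))"
  assumes n: "n \<ge> 1" and u: "\<forall>i\<in>{1..n}. u i \<ge> 1" and v: "\<forall>i\<in>{1..n}. v i \<ge> 1"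
    and sum_v: "(\<Sum>i=1..n. v i) \<ge> N + 1"
  obtains a :: "nat \<Rightarrow> real" where "\<And>k. a k \<in> \<rat>" "R sums (a 0 + (\<Sum>k=2..n. a k * zeta k))"
    "\<And>k. \<lbrakk>\<forall>i\<in>{1..n}. 2 * u i + v i = N + 1; k \<ge> 1; odd ((n + 1) * (N + 1) + k)\<rbrakk> \<Longrightarrow> a k = 0"
\<comment> \<open>For \<open>N = 0\<close> only the term \<open>m = 0\<close> of the series is
  nonzero, and it is rational. For \<open>N \<ge> 1\<close> the binomial coefficient is a polynomial
  in \<open>m\<close> of degree \<open>N - 1\<close>.\<close>
proof (cases "N = 0")
  case True
  have "R m = 0" if "m \<noteq> 0" for m
    using that True by (simp add: R_def)
  then have "R sums R 0"
    using sums_finite[of "{0}" R] by auto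
  moreover have "R 0 \<in> \<rat>"
    unfolding R_def by (intro Rats_mult Rats_divide Rats_prod Rats_add Rats_of_nat fact_in_Rats)
  ultimately show thesis
    by (intro that[of "\<lambda>k. if k = 0 then R 0 else 0"]) auto
next
  case False
  then have N: "N \<ge> 1" by simp
  define C :: real where "C = (\<Prod>i=1..n. fact (v i - 1)) / fact (N - 1)"
  obtain a where a: "\<And>k. a k \<in> \<rat>"
    "(\<lambda>m. (\<Prod>i=1..N - 1. real m + real i) / (\<Prod>i=1..n. \<Prod>j\<in>{u i..<u i + v i}. real m + real j))
       sums (a 0 + (\<Sum>k=2..n. a k * zeta k))"
    "\<And>k. \<lbrakk>\<forall>i\<in>{1..n}. v i \<ge> 1 \<and> 2 * u i + v i = N + 1; k \<ge> 1; odd ((n + 1) * (N + 1) + k)\<rbrakk> \<Longrightarrow> a k = 0"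
    by (fact summand_sums[OF n N u sum_v])
  have "m + N - 1 = m + (N - 1)" for m using N by simp
  then have "R = (\<lambda>m. C * ((\<Prod>i=1..N - 1. real m + real i) / (\<Prod>i=1..n. \<Prod>j\<in>{u i..<u i + v i}. real m + real j)))"
    by (simp add: R_def C_def binomial_eq_prod prod_dividef mult.commute)
  then have "R sums (C * a 0 + (\<Sum>k=2..n. C * a k * zeta k))"
    using sums_mult[OF a(2), of C] by (simp add: distrib_left sum_distrib_left mult.assoc)
  moreover have "C \<in> \<rat>"
    unfolding C_def by (intro Rats_divide Rats_prod fact_in_Rats)
  ultimately show thesis
    using a(1,3) v by (intro that[of "\<lambda>k. C * a k"]) auto
qed

theorem corollary5p6:
  fixes n N :: nat and u v :: "nat \<Rightarrow> nat"
  assumes "n \<ge> 1"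
    and "\<forall>i\<in>{1..n}. u i \<ge> 1"
    and "\<forall>i\<in>{1..n}. v i \<ge> 1"
    and "(\<Sum>i=1..n. v i) \<ge> N + 1"
  shows "set_integrable (lebesgue_pow n) (unit_cube n) (integrand n u v N) \<and>
    (\<exists>a :: nat \<Rightarrow> rat.
       (LINT x:unit_cube n|lebesgue_pow n. integrand n u v N x)
         = of_rat (a 0) + (\<Sum>k=2..n. of_rat (a k) * zeta k) \<and>
       ((\<forall>i\<in>{1..n}. 2 * u i + v i = N + 1) \<longrightarrow>
          (odd ((n + 1) * (N + 1)) \<longrightarrow> (\<forall>k\<in>{2..n}. even k \<longrightarrow> a k = 0)) \<and>
          (even ((n + 1) * (N + 1)) \<longrightarrow> (\<forall>k\<in>{2..n}. odd k \<longrightarrow> a k = 0))))"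
proof -
  obtain a :: "nat \<Rightarrow> real" where a: "\<And>k. a k \<in> \<rat>"
    "(\<lambda>m. real (m + N - 1 choose m) *
      (\<Prod>i=1..n. fact (v i - 1) / (\<Prod>j\<in>{u i..<u i + v i}. real m + real j)))
      sums (a 0 + (\<Sum>k=2..n. a k * zeta k))"
    "\<And>k. \<lbrakk>\<forall>i\<in>{1..n}. 2 * u i + v i = N + 1; k \<ge> 1; odd ((n + 1) * (N + 1) + k)\<rbrakk> \<Longrightarrow> a k = 0"
    by (fact integral_sums[OF assms])
  have "\<forall>k. \<exists>q. a k = of_rat q" using a(1) by (auto elim!: Rats_cases)
  then obtain q where q: "\<And>k. a k = of_rat (q k)" by metis
  have "set_integrable (lebesgue_pow n) (unit_cube n) (integrand n u v N)"
    using integrand_integral(1)[OF assms(1-3) sums_summable[OF a(2)]] .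
  moreover have "(LINT x:unit_cube n|lebesgue_pow n. integrand n u v N x)
      = of_rat (q 0) + (\<Sum>k=2..n. of_rat (q k) * zeta k)"
    using integrand_integral(2)[OF assms(1-3) sums_summable[OF a(2)]] sums_unique[OF a(2)]
    by (simp add: q)
  \<comment> \<open>An odd sum means that \<open>k\<close> and \<open>(n + 1) * (N + 1)\<close> have
    opposite parity, which covers both parity claims.\<close>
  moreover have "q k = 0" if "\<forall>i\<in>{1..n}. 2 * u i + v i = N + 1" "k \<ge> 2" "odd ((n + 1) * (N + 1) + k)" for k
    using a(3)[OF that(1) _ that(3)] that(2) by (simp add: q)
  ultimately show ?thesis
    by (intro conjI exI[of _ q]) auto
qed

end
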